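(* Let $T:V\to\mathfrak g$ be a relative Rota-Baxter operator on an $n$-LieRep pair $(\mathfrak g,[-,\cdots,-]_{\mathfrak g};\rho)$. Then there exists an $n$-pre-Lie algebra structure on $V$ given by $$\{u_1,\cdots,u_n\}_T=\rho(Tu_1,\cdots,Tu_{n-1})(u_n),\qquad\forall\,u_1,\cdots,u_n\in V.$$ Furthermore, $(V,[-,\cdots,-]_T)$ is the sub-adjacent $n$-Lie algebra of the $n$-pre-Lie algebra $(V,\{-,\cdots,-\}_T)$, where the bracket $[-,\cdots,-]_T:\wedge^nV\to V$ is given by $$[u_1,\cdots,u_n]_T=\sum_{i=1}^n(-1)^{n-i}\rho(Tu_1,\cdots,\widehat{Tu_i},\cdots,Tu_n)(u_i),$$ and $T$ is an $n$-Lie algebra morphism from $(V,[-,\cdots,-]_T)$ to $(\mathfrak g,[-,\cdots,-]_{\mathfrak g})$.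
   Context: All vector spaces are finite dimensional over an algebraically closed field of characteristic $0$; $n\ge2$; a hat denotes omission. An $n$-Lie algebra is a vector space $\mathfrak g$ with a skew-symmetric linear map $[-,\cdots,-]_{\mathfrak g}:\wedge^n\mathfrak g\to\mathfrak g$ such that $[x_1,\cdots,x_{n-1},[y_1,\cdots,y_n]]=\sum_{i=1}^n[y_1,\cdots,y_{i-1},[x_1,\cdots,x_{n-1},y_i],y_{i+1},\cdots,y_n]$. A representation of it on $V$ is a linear map $\rho:\wedge^{n-1}\mathfrak g\to\mathfrak{gl}(V)$ with (i) $[\rho(\mathfrak X),\rho(\mathfrak Y)]=\rho(\mathfrak X\circ\mathfrak Y)$ (commutator on the left), where for $\mathfrak X=x_1\wedge\cdots\wedge x_{n-1}$, $\mathfrak Y=y_1\wedge\cdots\wedge y_{n-1}$, $\mathfrak X\circ\mathfrak Y=\sum_{i=1}^{n-1}y_1\wedge\cdots\wedge[x_1,\cdots,x_{n-1},y_i]_{\mathfrak g}\wedge\cdots\wedge y_{n-1}$; and (ii) $\rho(x_1,\cdots,x_{n-2},[y_1,\cdots,y_n]_{\mathfrak g})=\sum_{i=1}^n(-1)^{n-i}\rho(y_1,\cdots,\widehat{y_i},\cdots,y_n)\rho(x_1,\cdots,x_{n-2},y_i)$. An $n$-LieRep pair $(\mathfrak g,[-,\cdots,-]_{\mathfrak g};\rho)$ is an $n$-Lie algebra together with a representation $\rho$ on a vector space $V$. A relative Rota-Baxter operator on it is a linear map $T:V\to\mathfrak g$ with $[Tv_1,\cdots,Tv_n]_{\mathfrak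 g}=\sum_{i=1}^n(-1)^{n-i}T(\rho(Tv_1,\cdots,\widehat{Tv_i},\cdots,Tv_n)(v_i))$ for all $v_i\in V$. An $n$-pre-Lie algebra is a vector space $A$ with a multilinear map $\{-,\cdots,-\}:\wedge^{n-1}A\otimes A\to A$ such that for all $x_i,y_j\in A$: (1) $\{x_1,\cdots,x_{n-1},\{y_1,\cdots,y_{n-1},y_n\}\}=\sum_{i=1}^{n-1}\{y_1,\cdots,y_{i-1},[x_1,\cdots,x_{n-1},y_i]_C,y_{i+1},\cdots,y_n\}+\{y_1,\cdots,y_{n-1},\{x_1,\cdots,x_{n-1},y_n\}\}$; (2) $\{[y_1,\cdots,y_n]_C,x_1,\cdots,x_{n-2},x_{n-1}\}=\sum_{i=1}^n(-1)^{n-i}\{y_1,\cdots,\widehat{y_i},\cdots,y_n,\{y_i,x_1,\cdots,x_{n-2},x_{n-1}\}\}$, where $[x_1,\cdots,x_n]_C=\sum_{i=1}^n(-1)^{n-i}\{x_1,\cdots,\widehat{x_i},\cdots,x_n,x_i\}$. The sub-adjacent $n$-Lie algebra of $(A,\{-,\cdots,-\})$ is $(A,[-,\cdots,-]_C)$. An $n$-Lie algebra morphism is a linear map preserving the $n$-brackets. *)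

theory Defs
  imports Complex_Main "HOL-Computational_Algebra.Polynomial"
begin

text \<open>
  A vector space is a type \<open>'v\<close> with a scalar multiplication \<open>s\<close> satisfying the library locale
  \<open>vector_space\<close>; finite dimensionality is the library locale \<open>finite_dimensional_vector_space\<close>.
  An \<open>m\<close>-ary operation takes a list of its arguments and is only constrained (and only looked at)
  on lists of length \<open>m\<close>. Positions in lists start at \<open>0\<close>, so a sign \<open>(-1)^(n-i)\<close> with
  \<open>i = 1, \<dots>, n\<close> is written \<open>(-1) ^ (n - Suc i)\<close> with \<open>i < n\<close>.
\<close>

definition omit :: "nat \<Rightarrow> 'a list \<Rightarrow> 'a list" where
  "omit i xs = take i xs @ drop (Suc i) xs"

definition multilinear ::
  "nat \<Rightarrow> ('k::field \<Rightarrow> 'v::ab_group_add \<Rightarrow> 'v) \<Rightarrow> ('k \<Rightarrow> 'w::ab_group_add \<Rightarrow> 'w) \<Rightarrow>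
   ('v list \<Rightarrow> 'w) \<Rightarrow> bool" where
  "multilinear m s1 s2 f \<longleftrightarrow>
     (\<forall>xs i. length xs = m \<longrightarrow> i < m \<longrightarrow> Vector_Spaces.linear s1 s2 (\<lambda>x. f (xs[i := x])))"

text \<open>
  Linear maps on the \<open>m\<close>-th exterior power are represented, via its universal property, by
  multilinear maps in \<open>m\<close> arguments that are alternating.
\<close>

definition alternating :: "nat \<Rightarrow> ('v list \<Rightarrow> 'w::zero) \<Rightarrow> bool" where
  "alternating m f \<longleftrightarrow>
     (\<forall>xs i j. length xs = m \<longrightarrow> i < j \<longrightarrow> j < m \<longrightarrow> xs ! i = xs ! j \<longrightarrow> f xs = 0)"

locale n_lie_algebra = vector_space s
  for n :: nat
  and s :: "'k::field \<Rightarrow> 'g::ab_group_add \<Rightarrow> 'g"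
  and br :: "'g list \<Rightarrow> 'g" +
  assumes arity: "n \<ge> 2"
  and br_multilinear: "multilinear n s s br"
  and br_alternating: "alternating n br"
  and fundamental_identity:
    "length xs = n - 1 \<Longrightarrow> length ys = n \<Longrightarrow>
       br (xs @ [br ys]) = (\<Sum>i<n. br (ys[i := br (xs @ [ys ! i])]))"

locale n_lie_rep_pair =
  g: n_lie_algebra n sg br + V: vector_space sV
  for n :: nat
  and sg :: "'k::field \<Rightarrow> 'g::ab_group_add \<Rightarrow> 'g"
  and br :: "'g list \<Rightarrow> 'g"
  and sV :: "'k \<Rightarrow> 'v::ab_group_add \<Rightarrow> 'v"
  and \<rho> :: "'g list \<Rightarrow> 'v \<Rightarrow> 'v" +
  assumes rep_endomorphism: "length xs = n - 1 \<Longrightarrow> Vector_Spaces.linear sV sV (\<rho> xs)"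
  and rep_multilinear: "multilinear (n - 1) sg sV (\<lambda>xs. \<rho> xs v)"
  and rep_alternating: "alternating (n - 1) (\<lambda>xs. \<rho> xs v)"
  and rep_commutator:
    "length xs = n - 1 \<Longrightarrow> length ys = n - 1 \<Longrightarrow>
       \<rho> xs (\<rho> ys v) - \<rho> ys (\<rho> xs v) = (\<Sum>i<n - 1. \<rho> (ys[i := br (xs @ [ys ! i])]) v)"
  and rep_bracket:
    "length xs = n - 2 \<Longrightarrow> length ys = n \<Longrightarrow>
       \<rho> (xs @ [br ys]) v =
         (\<Sum>i<n. sV ((- 1) ^ (n - Suc i)) (\<rho> (omit i ys) (\<rho> (xs @ [ys ! i]) v)))"

locale relative_rota_baxter =
  n_lie_rep_pair n sg br sV \<rho> + T: Vector_Spaces.linear sV sg T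
  for n :: nat
  and sg :: "'k::field \<Rightarrow> 'g::ab_group_add \<Rightarrow> 'g"
  and br :: "'g list \<Rightarrow> 'g"
  and sV :: "'k \<Rightarrow> 'v::ab_group_add \<Rightarrow> 'v"
  and \<rho> :: "'g list \<Rightarrow> 'v \<Rightarrow> 'v"
  and T :: "'v \<Rightarrow> 'g" +
  assumes rota_baxter:
    "length vs = n \<Longrightarrow>
       br (map T vs) =
         (\<Sum>i<n. sg ((- 1) ^ (n - Suc i)) (T (\<rho> (omit i (map T vs)) (vs ! i))))"

definition sub_adjacent ::
  "nat \<Rightarrow> ('k::field \<Rightarrow> 'a::ab_group_add \<Rightarrow> 'a) \<Rightarrow> ('a list \<Rightarrow> 'a) \<Rightarrow> 'a list \<Rightarrow> 'a" where
  "sub_adjacent n s pl xs = (\<Sum>i<n. s ((- 1) ^ (n - Suc i)) (pl (omit i xs @ [xs ! i])))"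

locale n_pre_lie_algebra = vector_space s
  for n :: nat
  and s :: "'k::field \<Rightarrow> 'a::ab_group_add \<Rightarrow> 'a"
  and pl :: "'a list \<Rightarrow> 'a" +
  assumes arity: "n \<ge> 2"
  and pl_multilinear: "multilinear n s s pl"
  and pl_alternating: "alternating (n - 1) (\<lambda>xs. pl (xs @ [x]))"
  and pre_lie_1:
    "length xs = n - 1 \<Longrightarrow> length ys = n - 1 \<Longrightarrow>
       pl (xs @ [pl (ys @ [y])]) =
         (\<Sum>i<n - 1. pl (ys[i := sub_adjacent n s pl (xs @ [ys ! i])] @ [y]))
         + pl (ys @ [pl (xs @ [y])])"
  and pre_lie_2:
    "length ys = n \<Longrightarrow> length xs = n - 2 \<Longrightarrow>
       pl ([sub_adjacent n s pl ys] @ xs @ [x]) =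
         (\<Sum>i<n. s ((- 1) ^ (n - Suc i)) (pl (omit i ys @ [pl ([ys ! i] @ xs @ [x])])))"

locale n_lie_morphism =
  dom: n_lie_algebra n s1 br1 + cod: n_lie_algebra n s2 br2 + Vector_Spaces.linear s1 s2 f
  for n :: nat
  and s1 :: "'k::field \<Rightarrow> 'g::ab_group_add \<Rightarrow> 'g"
  and br1 :: "'g list \<Rightarrow> 'g"
  and s2 :: "'k \<Rightarrow> 'h::ab_group_add \<Rightarrow> 'h"
  and br2 :: "'h list \<Rightarrow> 'h"
  and f :: "'g \<Rightarrow> 'h" +
  assumes preserves_bracket: "length xs = n \<Longrightarrow> f (br1 xs) = br2 (map f xs)"

definition rb_product ::
  "('g list \<Rightarrow> 'v \<Rightarrow> 'v) \<Rightarrow> ('v \<Rightarrow> 'g) \<Rightarrow> 'v list \<Rightarrow> 'v" where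
  "rb_product \<rho> T us = \<rho> (map T (butlast us)) (last us)"

definition rb_bracket ::
  "nat \<Rightarrow> ('k::field \<Rightarrow> 'v::ab_group_add \<Rightarrow> 'v) \<Rightarrow> ('g list \<Rightarrow> 'v \<Rightarrow> 'v) \<Rightarrow> ('v \<Rightarrow> 'g) \<Rightarrow>
   'v list \<Rightarrow> 'v" where
  "rb_bracket n s \<rho> T us =
     (\<Sum>i<n. s ((- 1) ^ (n - Suc i)) (\<rho> (omit i (map T us)) (us ! i)))"

end

theory Submission
  imports Defs
begin

text \<open>
  Everything rests on one observation: since \<open>T\<close> is a relative Rota-Baxter operator,
  \<open>T [u\<^sub>1, \<dots>, u\<^sub>n]\<^sub>T = [T u\<^sub>1, \<dots>, T u\<^sub>n]\<close> (lemma \<open>T_rb_bracket\<close>), and \<open>[-, \<dots>, -]\<^sub>T\<close> is the commutator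
  of \<open>{-, \<dots>, -}\<^sub>T\<close> by definition. Hence every occurrence of a commutator
  under \<open>\<rho>(T -, \<dots>, T -)\<close> becomes a bracket of \<open>\<gg>\<close>. The first \<open>n\<close>-pre-Lie identity is then the
  identity for the commutator of \<open>\<rho>(\<XX>)\<close> and \<open>\<rho>(\<YY>)\<close>, and the second one is the identity for
  \<open>\<rho>(x\<^sub>1, \<dots>, x\<^sub>n\<^sub>-\<^sub>2, [y\<^sub>1, \<dots>, y\<^sub>n])\<close>, after the
  bracket has been moved from the last to the first argument; this multiplies both
  sides by \<open>(-1)^(n-2)\<close> (lemma \<open>alternating_move\<close>).

  The fundamental identity of \<open>[-, \<dots>, -]\<^sub>T\<close> is read off directly from the representation. Expand
  \<open>[x\<^sub>1, \<dots>, x\<^sub>n\<^sub>-\<^sub>1, [y\<^sub>1, \<dots>, y\<^sub>n]\<^sub>T]\<^sub>T\<close>, using the identity for \<open>\<rho>(\<dots>, [T y\<^sub>1, \<dots>, T y\<^sub>n])\<close> where \<open>\<rho>\<close> acts on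
  some \<open>x\<^sub>k\<close>, and the commutator identity to exchange the operators in
  \<open>\<rho>(T x\<^sub>1, \<dots>, T x\<^sub>n\<^sub>-\<^sub>1) \<rho>(T y\<^sub>1, \<dots>, T y\<^sub>n) y\<^sub>j\<close> (with \<open>T y\<^sub>j\<close> omitted). The terms that are
  products of two operators add up to \<open>\<rho>(T y\<^sub>1, \<dots>, T y\<^sub>n) [x\<^sub>1, \<dots>, x\<^sub>n\<^sub>-\<^sub>1, y\<^sub>j]\<^sub>T\<close>, again without \<open>T y\<^sub>j\<close>;
  the remaining ones have a bracket in place of some \<open>T y\<^sub>i\<close> with \<open>i \<noteq> j\<close>. Together these are the
  terms of the brackets of \<open>y\<^sub>1, \<dots>, y\<^sub>n\<close> with one \<open>y\<^sub>i\<close> replaced by \<open>[x\<^sub>1, \<dots>, x\<^sub>n\<^sub>-\<^sub>1, y\<^sub>i]\<^sub>T\<close>.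
\<close>

section \<open>Omitting an entry of a list\<close>

text \<open>The increasing enumeration of the positions other than \<open>j\<close>.\<close>

definition skip :: "nat \<Rightarrow> nat \<Rightarrow> nat" where
  "skip j i = (if i < j then i else Suc i)"

lemma length_omit: "j < length xs \<Longrightarrow> length (omit j xs) = length xs - 1"
  by (simp add: omit_def)

lemma nth_omit: "j < length xs \<Longrightarrow> i < length xs - 1 \<Longrightarrow> omit j xs ! i = xs ! skip j i"
  by (simp add: omit_def skip_def nth_append)

lemma omit_map: "omit j (map f xs) = map f (omit j xs)"
  by (simp add: omit_def take_map drop_map)

lemma omit_update_same: "omit j (xs[j := x]) = omit j xs"
  by (simp add: omit_def)

lemma omit_update_skip:
  assumes "j < length xs" "i < length xs - 1"
  shows "omit j (xs[skip j i := x]) = (omit j xs)[i := x]"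
proof (rule nth_equalityI)
  show "length (omit j (xs[skip j i := x])) = length ((omit j xs)[i := x])"
    using assms by (simp add: length_omit)
next
  fix l assume "l < length (omit j (xs[skip j i := x]))"
  then have l: "l < length xs - 1" using assms by (simp add: length_omit)
  then show "omit j (xs[skip j i := x]) ! l = (omit j xs)[i := x] ! l"
    using assms by (auto simp: nth_omit nth_list_update length_omit skip_def split: if_splits)
qed

lemma omit_append_left: "k < length xs \<Longrightarrow> omit k (xs @ ys) = omit k xs @ ys"
  by (simp add: omit_def)

lemma omit_append_singleton: "omit (length xs) (xs @ [y]) = xs"
  by (simp add: omit_def)

lemma omit_nth_append: "omit (length as) (as @ a # bs) = as @ bs"
  by (simp add: omit_def)

lemma skip_range: "j < n \<Longrightarrow> i < n - 1 \<Longrightarrow> skip j i < n \<and> skip j i \<noteq> j"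
  by (auto simp: skip_def)

lemma skip_surj:
  assumes "j < n" "i < n" "i \<noteq> j"
  obtains l where "l < n - 1" "i = skip j l"
proof (cases "i < j")
  case True
  then show ?thesis using that[of i] assms by (simp add: skip_def)
next
  case False
  then show ?thesis using that[of "i - 1"] assms by (simp add: skip_def)
qed

lemma sum_skip:
  fixes f :: "nat \<Rightarrow> 'a::comm_monoid_add"
  assumes "j < n"
  shows "(\<Sum>i<n. f i) = f j + (\<Sum>l<n - 1. f (skip j l))"
proof -
  have "bij_betw (skip j) {..<n - 1} ({..<n} - {j})"
    unfolding bij_betw_def
  proof
    show "inj_on (skip j) {..<n - 1}"
      by (auto simp: inj_on_def skip_def split: if_splits)
    show "skip j ` {..<n - 1} = {..<n} - {j}"
    proof (intro equalityI subsetI)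
      fix i assume "i \<in> {..<n} - {j}"
      then obtain l where "l < n - 1" "i = skip j l"
        using skip_surj[OF assms, of i] by auto
      then show "i \<in> skip j ` {..<n - 1}" by simp
    qed (use assms skip_range in auto)
  qed
  from sum.reindex_bij_betw[OF this, of f] show ?thesis
    using assms by (simp add: sum.remove[of "{..<n}" j f])
qed

section \<open>Multilinear and alternating maps\<close>

lemma multilinear_append:
  assumes "multilinear m s1 s2 f" "length as + Suc (length bs) = m"
  shows "Vector_Spaces.linear s1 s2 (\<lambda>x. f (as @ x # bs))"
proof -
  have "length (as @ undefined # bs) = m" "length as < m"
    using assms(2) by simp_all
  then have "Vector_Spaces.linear s1 s2 (\<lambda>x. f ((as @ undefined # bs)[length as := x]))"
    using assms(1) unfolding multilinear_def by blast
  then show ?thesis by simp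
qed

lemma alternating_append:
  assumes "alternating m f" "length as + length bs + length cs + 2 = m"
  shows "f (as @ a # bs @ a # cs) = 0"
proof -
  let ?xs = "as @ a # bs @ a # cs" and ?j = "length as + Suc (length bs)"
  have "?xs ! length as = ?xs ! ?j"
    by (simp only: nth_append_length nth_append_length_plus nth_Cons_Suc)
  moreover have "length ?xs = m" "length as < ?j" "?j < m" using assms(2) by simp_all
  ultimately show ?thesis using assms(1) unfolding alternating_def by blast
qed

lemma alternating_swap:
  assumes "multilinear m s1 s2 f" "alternating m f" "length as + length cs + 2 = m"
  shows "f (as @ x # y # cs) = - f (as @ y # x # cs)"
proof -
  have L: "Vector_Spaces.linear s1 s2 (\<lambda>a. f (as @ a # b # cs))" for b
    using multilinear_append[OF assms(1), of as "b # cs"] assms(3) by simp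
  have R: "Vector_Spaces.linear s1 s2 (\<lambda>b. f (as @ a # b # cs))" for a
    using multilinear_append[OF assms(1), of "as @ [a]" cs] assms(3) by simp
  have Z: "f (as @ a # a # cs) = 0" for a
    using alternating_append[OF assms(2), of as "[]" cs a] assms(3) by simp
  have "0 = f (as @ (x + y) # (x + y) # cs)" by (simp only: Z)
  also have "\<dots> = f (as @ x # (x + y) # cs) + f (as @ y # (x + y) # cs)"
    using L unfolding Vector_Spaces.linear_iff by blast
  also have "f (as @ x # (x + y) # cs) = f (as @ x # x # cs) + f (as @ x # y # cs)"
    using R unfolding Vector_Spaces.linear_iff by blast
  also have "f (as @ y # (x + y) # cs) = f (as @ y # x # cs) + f (as @ y # y # cs)"
    using R unfolding Vector_Spaces.linear_iff by blast
  finally show ?thesis by (simp add: Z eq_neg_iff_add_eq_0)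
qed

text \<open>An argument that passes over the arguments \<open>bs\<close> picks up one sign for each of them.\<close>

lemma alternating_move:
  assumes "multilinear m s1 s2 f" "alternating m f" "vector_space s2"
    and "length as + length bs + length cs + 1 = m"
  shows "f (as @ x # bs @ cs) = s2 ((- 1) ^ length bs) (f (as @ bs @ x # cs))"
  using assms(4)
proof (induction bs arbitrary: as)
  case Nil
  interpret vector_space s2 by fact
  show ?case by simp
next
  case (Cons b bs)
  interpret vector_space s2 by fact
  have "f (as @ x # (b # bs) @ cs) = - f (as @ b # x # bs @ cs)"
    using alternating_swap[OF assms(1,2), of as "bs @ cs" x b] Cons.prems by simp
  also have "f (as @ b # x # bs @ cs) = s2 ((- 1) ^ length bs) (f (as @ b # bs @ x # cs))"
    using Cons.IH[of "as @ [b]"] Cons.prems by simp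
  finally show ?case by simp
qed

section \<open>The bracket and the product of a relative Rota-Baxter operator\<close>

context relative_rota_baxter
begin

lemma rep_sum: "length xs = n - 1 \<Longrightarrow> \<rho> xs (sum f A) = (\<Sum>a\<in>A. \<rho> xs (f a))"
  by (rule module_hom.sum[OF Vector_Spaces.linear.axioms(3)[OF rep_endomorphism]])

lemma rep_scale: "length xs = n - 1 \<Longrightarrow> \<rho> xs (sV c v) = sV c (\<rho> xs v)"
  using rep_endomorphism unfolding Vector_Spaces.linear_iff by blast

lemma rep_add: "length xs = n - 1 \<Longrightarrow> \<rho> xs (v + w) = \<rho> xs v + \<rho> xs w"
  using rep_endomorphism unfolding Vector_Spaces.linear_iff by blast

lemma T_linear: "Vector_Spaces.linear sV sg T"
  by unfold_locales

lemma rep_T_linear: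
  assumes "length us = n - 1" "i < n - 1"
  shows "Vector_Spaces.linear sV sV (\<lambda>x. \<rho> (map T (us[i := x])) v)"
proof -
  have "Vector_Spaces.linear sg sV (\<lambda>x. \<rho> ((map T us)[i := x]) v)"
    using rep_multilinear assms unfolding multilinear_def by simp
  from Vector_Spaces.linear_compose[OF T_linear this] show ?thesis by (simp add: o_def map_update)
qed

lemma rb_product_snoc: "rb_product \<rho> T (us @ [v]) = \<rho> (map T us) v"
  by (simp add: rb_product_def)

lemma rb_bracket_sub_adjacent: "rb_bracket n sV \<rho> T us = sub_adjacent n sV (rb_product \<rho> T) us"
  by (simp add: rb_bracket_def sub_adjacent_def rb_product_snoc omit_map)

lemma T_rb_bracket: "length us = n \<Longrightarrow> T (rb_bracket n sV \<rho> T us) = br (map T us)"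
  by (simp add: rota_baxter rb_bracket_def T.sum T.scale)

lemma rb_product_multilinear: "multilinear n sV sV (rb_product \<rho> T)"
  unfolding multilinear_def
proof (intro allI impI)
  fix us :: "'v list" and i assume us: "length us = n" and i: "i < n"
  have "us \<noteq> []" using us i by auto
  then obtain vs v where vs: "us = vs @ [v]" by (metis append_butlast_last_id)
  show "Vector_Spaces.linear sV sV (\<lambda>x. rb_product \<rho> T (us[i := x]))"
  proof (cases "i < length vs")
    case True
    then show ?thesis
      using rep_T_linear[of vs i v] us vs by (simp add: list_update_append rb_product_snoc)
  next
    case False
    then have "i = length vs" using vs us i by simp
    then show ?thesis
      using rep_endomorphism[of "map T vs"] us vs by (simp add: rb_product_snoc)
  qed
qed

lemma rb_bracket_multilinear: "multilinear n sV sV (rb_bracket n sV \<rho> T)"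
  unfolding multilinear_def
proof (intro allI impI)
  interpret VV: vector_space_pair sV sV by unfold_locales
  fix us :: "'v list" and j assume us: "length us = n" and j: "j < n"
  have "Vector_Spaces.linear sV sV (\<lambda>x. \<rho> (map T (omit i (us[j := x]))) (us[j := x] ! i))"
    if i: "i < n" for i
  proof (cases "i = j")
    case True
    then show ?thesis
      using rep_endomorphism[of "map T (omit i us)"] us i
      by (simp add: omit_update_same length_omit)
  next
    case False
    then obtain l where "l < n - 1" "j = skip i l" using skip_surj[of i n j] i j by auto
    then show ?thesis
      using rep_T_linear[of "omit i us" l "us ! i"] False us i
      by (simp add: omit_update_skip length_omit)
  qed
  then show "Vector_Spaces.linear sV sV (\<lambda>x. rb_bracket n sV \<rho> T (us[j := x]))"
    unfolding rb_bracket_def omit_map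
    by (intro VV.linear_compose_sum VV.linear_compose_scale_right ballI) simp
qed

text \<open>
  When two entries agree, only the two terms omitting one of them survive; they cancel because
  the remaining lists differ by moving the common entry across the entries in between.
\<close>

lemma rb_bracket_alternating: "alternating n (rb_bracket n sV \<rho> T)"
  unfolding alternating_def
proof (intro allI impI)
  fix us :: "'v list" and i j
  assume us: "length us = n" and ij: "i < j" and j: "j < n" and eq: "us ! i = us ! j"
  define a as bs cs where "a = us ! i" and "as = take i us"
    and "bs = take (j - Suc i) (drop (Suc i) us)" and "cs = drop (Suc j) us"
  have "drop (Suc i) us = bs @ a # cs"
    using us ij j eq unfolding a_def bs_def cs_def
    using id_take_nth_drop[of "j - Suc i" "drop (Suc i) us"] by simp
  then have us_eq: "us = as @ a # bs @ a # cs"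
    using us ij j unfolding a_def as_def
    using id_take_nth_drop[of i us] by simp
  have len: "length as = i" "length bs = j - Suc i" "length as + length bs + length cs + 2 = n"
    using us ij j by (auto simp: as_def bs_def cs_def)
  have omit_i: "omit i us = as @ bs @ a # cs"
    using omit_nth_append[of as a "bs @ a # cs"] len us_eq by simp
  have omit_j: "omit j us = as @ a # bs @ cs"
    using omit_nth_append[of "as @ a # bs" a cs] len us_eq ij by simp
  define t where "t k = sV ((- 1) ^ (n - Suc k)) (\<rho> (map T (omit k us)) (us ! k))" for k
  have "t k = 0" if k: "k < n" "k \<noteq> i" "k \<noteq> j" for k
  proof -
    obtain p where p: "p < n - 1" "i = skip k p" using skip_surj[of k n i] k ij j by auto
    obtain q where q: "q < n - 1" "j = skip k q" using skip_surj[of k n j] k j by auto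
    have "p < q" using p q ij by (auto simp: skip_def split: if_splits)
    moreover have "omit k us ! p = omit k us ! q" using p q eq us k by (simp add: nth_omit)
    ultimately have "\<rho> (map T (omit k us)) v = 0" for v
      using rep_alternating[of v] p q us k unfolding alternating_def
      by (simp add: length_omit)
    then show ?thesis by (simp add: t_def)
  qed
  then have "rb_bracket n sV \<rho> T us = sum t {i, j}"
    unfolding rb_bracket_def omit_map t_def[symmetric]
    using ij j by (intro sum.mono_neutral_right) auto
  also have "\<dots> = t i + t j" using ij by simp
  also have "t j = sV ((- 1) ^ (n - Suc j)) (sV ((- 1) ^ (j - Suc i)) (\<rho> (map T (omit i us)) a))"
    using alternating_move[OF rep_multilinear rep_alternating V.vector_space_axioms,
        of "map T as" "map T bs" "map T cs" "T a" a] len eq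
    by (simp add: t_def omit_i omit_j a_def)
  also have "\<dots> = sV ((- 1) ^ (n - Suc j + (j - Suc i))) (\<rho> (map T (omit i us)) a)"
    by (simp add: power_add)
  also have "t i = sV ((- 1) ^ Suc (n - Suc j + (j - Suc i))) (\<rho> (map T (omit i us)) a)"
  proof -
    have "n - Suc i = Suc (n - Suc j + (j - Suc i))" using ij j by simp
    then show ?thesis by (simp add: t_def a_def)
  qed
  finally show "rb_bracket n sV \<rho> T us = 0" by simp
qed

text \<open>The bracket of \<open>V\<close> with its last argument separated from the others.\<close>

lemma rb_bracket_snoc:
  assumes "length xs = n - 1"
  shows "rb_bracket n sV \<rho> T (xs @ [w]) = \<rho> (map T xs) w
    + (\<Sum>k<n - 1. sV ((- 1) ^ (n - Suc k)) (\<rho> (map T (omit k xs) @ [T w]) (xs ! k)))"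
proof -
  have n: "n = Suc (n - 1)" using g.arity by simp
  define t where "t k = sV ((- 1) ^ (n - Suc k)) (\<rho> (map T (omit k (xs @ [w]))) ((xs @ [w]) ! k))"
    for k
  have "rb_bracket n sV \<rho> T (xs @ [w]) = sum t {..<n}"
    unfolding rb_bracket_def omit_map t_def ..
  also have "\<dots> = t (n - 1) + sum t {..<n - 1}"
    by (subst (1) n) (simp add: add.commute)
  also have "t (n - 1) = \<rho> (map T xs) w"
    using g.arity omit_append_singleton[of xs w] nth_append_length[of xs w "[]"] assms
    by (simp add: t_def)
  also have "sum t {..<n - 1}
    = (\<Sum>k<n - 1. sV ((- 1) ^ (n - Suc k)) (\<rho> (map T (omit k xs) @ [T w]) (xs ! k)))"
    using assms by (intro sum.cong) (simp_all add: t_def omit_append_left nth_append)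
  finally show ?thesis .
qed

section \<open>The Lie and pre-Lie identities\<close>

text \<open>The commutator identity of the representation, with the bracket of \<open>V\<close> inside \<open>\<rho>\<close>.\<close>

lemma rb_commutator:
  assumes "length xs = n - 1" "length ys = n - 1"
  shows "\<rho> (map T xs) (\<rho> (map T ys) v) = \<rho> (map T ys) (\<rho> (map T xs) v)
    + (\<Sum>i<n - 1. \<rho> (map T (ys[i := rb_bracket n sV \<rho> T (xs @ [ys ! i])])) v)"
proof -
  have "n - 1 + 1 = n" using g.arity by simp
  then have "map T (ys[i := rb_bracket n sV \<rho> T (xs @ [ys ! i])])
      = (map T ys)[i := br (map T xs @ [map T ys ! i])]" if "i < n - 1" for i
    using assms that T_rb_bracket[of "xs @ [ys ! i]"] by (simp add: map_update)
  then show ?thesis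
    using rep_commutator[of "map T xs" "map T ys" v] assms by (simp add: algebra_simps)
qed

lemma rb_bracket_fundamental:
  assumes xs: "length xs = n - 1" and ys: "length ys = n"
  defines "B \<equiv> rb_bracket n sV \<rho> T"
  shows "B (xs @ [B ys]) = (\<Sum>i<n. B (ys[i := B (xs @ [ys ! i])]))"
proof -
  define \<epsilon> :: "nat \<Rightarrow> 'k" where "\<epsilon> i = (- 1) ^ (n - Suc i)" for i
  define z where "z i = B (xs @ [ys ! i])" for i
  define R where "R us = \<rho> (map T us)" for us
  have B: "B us = (\<Sum>i<n. sV (\<epsilon> i) (R (omit i us) (us ! i)))" for us
    by (simp add: B_def rb_bracket_def \<epsilon>_def R_def omit_map)
  have len: "length (omit j ys) = n - 1" if "j < n" for j using that ys by (simp add: length_omit)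
  have n2: "n - 1 - 1 = n - 2" "Suc (n - 2) = n - 1" using g.arity by auto
  define P where "P j k = \<rho> (map T (omit k xs) @ [T (ys ! j)]) (xs ! k)" for j k
  have z: "z j = R xs (ys ! j) + (\<Sum>k<n - 1. sV (\<epsilon> k) (P j k))" for j
    unfolding z_def P_def B_def R_def \<epsilon>_def by (rule rb_bracket_snoc[OF xs])
  have bracket_terms: "\<rho> (map T (omit k xs) @ [T (B ys)]) (xs ! k)
      = (\<Sum>j<n. sV (\<epsilon> j) (R (omit j ys) (P j k)))" if k: "k < n - 1" for k
  proof -
    have "length (map T (omit k xs)) = n - 2" using k xs n2 by (simp add: length_omit)
    from rep_bracket[OF this, of "map T ys" "xs ! k"] show ?thesis
      using T_rb_bracket[OF ys] ys by (simp add: B_def \<epsilon>_def R_def P_def omit_map)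
  qed
  \<comment> \<open>The position \<open>l\<close> of \<open>omit j ys\<close> is the position \<open>skip j l\<close> of \<open>ys\<close>.\<close>
  have commutator_terms: "R xs (R (omit j ys) (ys ! j)) = R (omit j ys) (R xs (ys ! j))
      + (\<Sum>l<n - 1. R (omit j (ys[skip j l := z (skip j l)])) (ys ! j))" if j: "j < n" for j
  proof -
    have "(omit j ys)[l := B (xs @ [omit j ys ! l])] = omit j (ys[skip j l := z (skip j l)])"
      if "l < n - 1" for l
      using that j ys by (simp add: nth_omit omit_update_skip z_def)
    then show ?thesis
      using rb_commutator[OF xs len[OF j], of "ys ! j"] by (simp add: R_def B_def)
  qed
  have "B (xs @ [B ys]) = R xs (B ys)
      + (\<Sum>k<n - 1. sV (\<epsilon> k) (\<rho> (map T (omit k xs) @ [T (B ys)]) (xs ! k)))"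
    unfolding B_def R_def \<epsilon>_def by (rule rb_bracket_snoc[OF xs])
  also have "R xs (B ys) = (\<Sum>j<n. sV (\<epsilon> j) (R xs (R (omit j ys) (ys ! j))))"
    unfolding B[of ys] using xs by (simp add: R_def rep_sum rep_scale)
  also have "(\<Sum>k<n - 1. sV (\<epsilon> k) (\<rho> (map T (omit k xs) @ [T (B ys)]) (xs ! k)))
      = (\<Sum>k<n - 1. \<Sum>j<n. sV (\<epsilon> k) (sV (\<epsilon> j) (R (omit j ys) (P j k))))"
    by (simp add: bracket_terms V.scale_sum_right)
  also have "\<dots> = (\<Sum>j<n. sV (\<epsilon> j) (\<Sum>k<n - 1. sV (\<epsilon> k) (R (omit j ys) (P j k))))"
    by (subst sum.swap) (simp add: V.scale_sum_right mult.commute)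
  also have "\<dots> = (\<Sum>j<n. sV (\<epsilon> j) (R (omit j ys) (\<Sum>k<n - 1. sV (\<epsilon> k) (P j k))))"
    using len by (simp add: R_def rep_sum rep_scale)
  also have "(\<Sum>j<n. sV (\<epsilon> j) (R xs (R (omit j ys) (ys ! j)))) + \<dots>
      = (\<Sum>j<n. sV (\<epsilon> j) (R (omit j ys) (z j)
          + (\<Sum>l<n - 1. R (omit j (ys[skip j l := z (skip j l)])) (ys ! j))))"
    unfolding sum.distrib[symmetric] V.scale_right_distrib[symmetric]
  proof (intro sum.cong refl arg_cong[where f = "sV _"])
    fix j assume "j \<in> {..<n}"
    then have j: "j < n" by simp
    have "R (omit j ys) (z j)
        = R (omit j ys) (R xs (ys ! j)) + R (omit j ys) (\<Sum>k<n - 1. sV (\<epsilon> k) (P j k))"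
      unfolding z[of j] using len[OF j] by (simp add: R_def rep_add)
    then show "R xs (R (omit j ys) (ys ! j)) + R (omit j ys) (\<Sum>k<n - 1. sV (\<epsilon> k) (P j k))
        = R (omit j ys) (z j)
          + (\<Sum>l<n - 1. R (omit j (ys[skip j l := z (skip j l)])) (ys ! j))"
      by (simp add: commutator_terms[OF j] add.assoc add.commute add.left_commute)
  qed
  \<comment> \<open>Both kinds of terms are one sum over \<open>i\<close>: \<open>i = j\<close> gives \<open>z j\<close>, since \<open>omit j\<close> removes the
    replaced entry, and the other \<open>i\<close> are the values of \<open>skip j\<close>.\<close>
  also have "\<dots> = (\<Sum>j<n. sV (\<epsilon> j) (\<Sum>i<n. R (omit j (ys[i := z i])) (ys[i := z i] ! j)))"
  proof (rule sum.cong[OF refl])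
    fix j assume "j \<in> {..<n}"
    then have j: "j < n" by simp
    have "(\<Sum>i<n. R (omit j (ys[i := z i])) (ys[i := z i] ! j)) = R (omit j ys) (z j)
        + (\<Sum>l<n - 1. R (omit j (ys[skip j l := z (skip j l)])) (ys ! j))"
      using j ys skip_range[OF j] by (subst sum_skip[OF j]) (simp add: omit_update_same)
    then show "sV (\<epsilon> j) (R (omit j ys) (z j)
          + (\<Sum>l<n - 1. R (omit j (ys[skip j l := z (skip j l)])) (ys ! j)))
        = sV (\<epsilon> j) (\<Sum>i<n. R (omit j (ys[i := z i])) (ys[i := z i] ! j))"
      by simp
  qed
  also have "\<dots> = (\<Sum>i<n. B (ys[i := z i]))"
    unfolding B V.scale_sum_right by (rule sum.swap)
  finally show ?thesis by (simp add: z_def)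
qed

lemma n_lie_algebra_rb_bracket: "n_lie_algebra n sV (rb_bracket n sV \<rho> T)"
  using g.arity rb_bracket_multilinear rb_bracket_alternating rb_bracket_fundamental
  by unfold_locales

lemma rb_product_pre_lie_1:
  assumes "length xs = n - 1" "length ys = n - 1"
  shows "rb_product \<rho> T (xs @ [rb_product \<rho> T (ys @ [y])]) =
    (\<Sum>i<n - 1. rb_product \<rho> T
       (ys[i := sub_adjacent n sV (rb_product \<rho> T) (xs @ [ys ! i])] @ [y]))
    + rb_product \<rho> T (ys @ [rb_product \<rho> T (xs @ [y])])"
  using rb_commutator[OF assms, of y]
  by (simp add: rb_product_snoc rb_bracket_sub_adjacent[symmetric] add.commute)

lemma rb_product_pre_lie_2:
  assumes ys: "length ys = n" and xs: "length xs = n - 2"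
  shows "rb_product \<rho> T ([sub_adjacent n sV (rb_product \<rho> T) ys] @ xs @ [x]) =
    (\<Sum>i<n. sV ((- 1) ^ (n - Suc i))
      (rb_product \<rho> T (omit i ys @ [rb_product \<rho> T ([ys ! i] @ xs @ [x])])))"
proof -
  have n2: "Suc (n - 2) = n - 1" using g.arity by simp
  have product: "rb_product \<rho> T ([u] @ xs @ [x])
      = sV ((- 1) ^ (n - 2)) (\<rho> (map T xs @ [T u]) x)" for u
    using alternating_move[OF rep_multilinear rep_alternating V.vector_space_axioms,
        of "[]" "map T xs" "[]" "T u" x] xs n2 rb_product_snoc[of "u # xs" x] by simp
  show ?thesis
    unfolding product rb_bracket_sub_adjacent[symmetric] T_rb_bracket[OF ys]
    using rep_bracket[of "map T xs" "map T ys" x] xs ys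
    by (simp add: rb_product_snoc omit_map rep_scale length_omit V.scale_sum_right mult.commute)
qed

lemma n_pre_lie_algebra_rb_product: "n_pre_lie_algebra n sV (rb_product \<rho> T)"
proof
  show "alternating (n - 1) (\<lambda>us. rb_product \<rho> T (us @ [v]))" for v
    using rep_alternating[of v] unfolding alternating_def rb_product_snoc
    by simp
qed (fact g.arity rb_product_multilinear rb_product_pre_lie_1 rb_product_pre_lie_2)+

lemma n_lie_morphism_rb_bracket: "n_lie_morphism n sV (rb_bracket n sV \<rho> T) sg br T"
  using n_lie_algebra_rb_bracket g.n_lie_algebra_axioms T_linear T_rb_bracket
  by (simp add: n_lie_morphism_def n_lie_morphism_axioms_def)

end

theorem proposition3p18:
  fixes n :: nat
    and sg :: "'k::{alg_closed_field, field_char_0} \<Rightarrow> 'g::ab_group_add \<Rightarrow> 'g"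
    and sV :: "'k \<Rightarrow> 'v::ab_group_add \<Rightarrow> 'v"
    and br :: "'g list \<Rightarrow> 'g"
    and \<rho> :: "'g list \<Rightarrow> 'v \<Rightarrow> 'v"
    and T :: "'v \<Rightarrow> 'g"
  assumes "finite_dimensional_vector_space sg Bg"
    and "finite_dimensional_vector_space sV BV"
    and "n \<ge> 2"
    and "n_lie_rep_pair n sg br sV \<rho>"
    and "relative_rota_baxter n sg br sV \<rho> T"
  shows "n_pre_lie_algebra n sV (rb_product \<rho> T)
    \<and> n_lie_algebra n sV (rb_bracket n sV \<rho> T)
    \<and> (\<forall>us. length us = n \<longrightarrow>
          rb_bracket n sV \<rho> T us = sub_adjacent n sV (rb_product \<rho> T) us)
    \<and> n_lie_morphism n sV (rb_bracket n sV \<rho> T) sg br T"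
proof -
  interpret relative_rota_baxter n sg br sV \<rho> T by fact
  show ?thesis
    using n_pre_lie_algebra_rb_product n_lie_algebra_rb_bracket rb_bracket_sub_adjacent
      n_lie_morphism_rb_bracket by blast
qed

end
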